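(* Let $H:\mathbb{R}^n\to\mathbb{R}$ be convex with $H(0)=\min_{\mathbb{R}^n}H=0$ and such that $\{p:H(p)=0\}$ is bounded and has empty interior, and let $U\subset\mathbb{R}^n$ be open. If $u\in\mathrm{Lip}_{\mathrm{loc}}(U)$ satisfies the pointwise convexity criterion in $U$, then $u$ is a viscosity subsolution in $U$ of the Aronsson equation $H_{p_i}(Du)H_{p_j}(Du)u_{x_ix_j}=0$.
   Context: $V\ll U$ means that $V$ is open and $\bar V$ is a compact subset of $U$. $\mathrm{Lip}_{\mathrm{loc}}(U)$ is the set of functions $U\to\mathbb{R}$ that are Lipschitz continuous on every $V\ll U$. The Lagrangian is $L(q):=\sup_{p\in\mathbb{R}^n}(p\cdot q-H(p))\in[0,\infty]$. For bounded $u:U\to\mathbb{R}$ and $x\in U$, $T^tu(x):=\sup_{y\in U}\left(u(y)-tL\left(\frac{y-x}{t}\right)\right)$ for $t>0$, $T^0u(x):=u(x)$, and $S^+u(x):=\limsup_{t\downarrow0}\frac{T^tu(x)-u(x)}{t}$. Pointwise convexity criterion in $U$: $u\in\mathrm{Lip}_{\mathrm{loc}}(U)$ is bounded, the map $x\mapsto S^+u(x)$ is upper semicontinuous in $U$, and for each $x\in U$ there exists $\delta(x)>0$ such that $t\mapsto T^tu(x)$ is convex on $[0,\delta(x)]$. $\partial H(p_0)$ denotes the subdifferential: $y_0\in\partial H(p_0)$ iff $H(p)\ge H(p_0)+(p-p_0)\cdot y_0$ for all $p\in\mathbb{R}^n$. Since $H$ need not be differentiable, the Aronsson equation is interpreted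 as follows: $u$ is a viscosity subsolution of it in $U$ if $u$ is upper semicontinuous and, whenever $u-\varphi$ has a local maximum at $x_0\in U$ for some smooth $\varphi$, one has $\max_{\omega\in\partial H(D\varphi(x_0))}\omega\cdot D^2\varphi(x_0)\omega\ge0$. *)

theory Defs
  imports "HOL-Analysis.Analysis"
begin

definition compactly_inside :: "'a::topological_space set \<Rightarrow> 'a set \<Rightarrow> bool" (infix "\<lless>" 50)
  where "V \<lless> U \<longleftrightarrow> open V \<and> compact (closure V) \<and> closure V \<subseteq> U"

definition lip_loc :: "'a::metric_space set \<Rightarrow> ('a \<Rightarrow> real) \<Rightarrow> bool"
  where "lip_loc U u \<longleftrightarrow> (\<forall>V. V \<lless> U \<longrightarrow> (\<exists>C. C-lipschitz_on V u))"

definition usc_on :: "'a::topological_space set \<Rightarrow> ('a \<Rightarrow> 'b::linorder) \<Rightarrow> bool"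
  where "usc_on U f \<longleftrightarrow> (\<forall>x\<in>U. \<forall>c. f x < c \<longrightarrow> (\<forall>\<^sub>F y in at x within U. f y < c))"

definition lagrangian :: "(real^'n \<Rightarrow> real) \<Rightarrow> real^'n \<Rightarrow> ereal"
  where "lagrangian H q = (SUP p. ereal (p \<bullet> q - H p))"

text \<open>Only times \<open>t \<ge> 0\<close> are meaningful. If \<open>u\<close> is bounded on \<open>U\<close> and
  \<open>H 0 = min H = 0\<close>, then \<open>lagrangian H 0 = 0 \<le> lagrangian H q\<close>; hence for \<open>x \<in> U\<close> the
  value of \<open>hopf_lax\<close> lies between \<open>u x\<close> and the supremum of \<open>u\<close> over \<open>U\<close>. It is
  therefore finite, and \<open>real_of_ereal\<close> in the criterion below loses nothing.\<close>

definition hopf_lax :: "(real^'n \<Rightarrow> real) \<Rightarrow> (real^'n) set \<Rightarrow> (real^'n \<Rightarrow> real) \<Rightarrow> real \<Rightarrow> real^'n \<Rightarrow> ereal"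
  where "hopf_lax H U u t x =
    (if t = 0 then ereal (u x)
     else (SUP y\<in>U. ereal (u y) - ereal t * lagrangian H ((1 / t) *\<^sub>R (y - x))))"

definition slope_plus :: "(real^'n \<Rightarrow> real) \<Rightarrow> (real^'n) set \<Rightarrow> (real^'n \<Rightarrow> real) \<Rightarrow> real^'n \<Rightarrow> ereal"
  where "slope_plus H U u x =
    Limsup (at_right 0) (\<lambda>t. (hopf_lax H U u t x - ereal (u x)) / ereal t)"

definition pointwise_convexity_criterion ::
    "(real^'n \<Rightarrow> real) \<Rightarrow> (real^'n) set \<Rightarrow> (real^'n \<Rightarrow> real) \<Rightarrow> bool"
  where "pointwise_convexity_criterion H U u \<longleftrightarrow>
    lip_loc U u \<and> bounded (u ` U) \<and> usc_on U (slope_plus H U u) \<and>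
    (\<forall>x\<in>U. \<exists>\<delta>>0. convex_on {0..\<delta>} (\<lambda>t. real_of_ereal (hopf_lax H U u t x)))"

definition subdifferential :: "(real^'n \<Rightarrow> real) \<Rightarrow> real^'n \<Rightarrow> (real^'n) set"
  where "subdifferential H p0 = {y0. \<forall>p. H p \<ge> H p0 + (p - p0) \<bullet> y0}"

definition partial :: "'n \<Rightarrow> (real^'n \<Rightarrow> real) \<Rightarrow> real^'n \<Rightarrow> real"
  where "partial i f x = frechet_derivative f (at x) (axis i 1)"

definition gradient :: "(real^'n \<Rightarrow> real) \<Rightarrow> real^'n \<Rightarrow> real^'n"
  where "gradient f x = (\<chi> i. partial i f x)"

definition hessian :: "(real^'n \<Rightarrow> real) \<Rightarrow> real^'n \<Rightarrow> real^'n^'n"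
  where "hessian f x = (\<chi> i j. partial j (partial i f) x)"

primrec Ck_on :: "nat \<Rightarrow> (real^'n) set \<Rightarrow> (real^'n \<Rightarrow> real) \<Rightarrow> bool"
  where
    "Ck_on 0 U f \<longleftrightarrow> continuous_on U f"
  | "Ck_on (Suc k) U f \<longleftrightarrow>
      (\<forall>x\<in>U. f differentiable (at x)) \<and> (\<forall>i. Ck_on k U (partial i f))"

text \<open>Intended for open \<open>U\<close>, since \<open>partial\<close> uses full neighbourhoods.\<close>

definition smooth_on :: "(real^'n) set \<Rightarrow> (real^'n \<Rightarrow> real) \<Rightarrow> bool"
  where "smooth_on U f \<longleftrightarrow> (\<forall>k. Ck_on k U f)"

text \<open>The subdifferential at \<open>gradient \<phi> x0\<close> is to be read as the set of possible values
  of \<open>DH\<close> there. The last clause says that the maximum of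
  \<open>\<omega> \<bullet> (hessian \<phi> x0 *v \<omega>)\<close> over this set is attained and is nonnegative. Test functions
  need only be smooth on \<open>U\<close>, not on the whole space.\<close>

definition aronsson_viscosity_subsolution ::
    "(real^'n \<Rightarrow> real) \<Rightarrow> (real^'n) set \<Rightarrow> (real^'n \<Rightarrow> real) \<Rightarrow> bool"
  where "aronsson_viscosity_subsolution H U u \<longleftrightarrow>
    usc_on U u \<and>
    (\<forall>\<phi>. \<forall>x0\<in>U. smooth_on U \<phi> \<longrightarrow>
      (\<forall>\<^sub>F y in at x0 within U. u y - \<phi> y \<le> u x0 - \<phi> x0) \<longrightarrow>
      (\<exists>\<omega>\<in>subdifferential H (gradient \<phi> x0).
        (\<forall>\<omega>'\<in>subdifferential H (gradient \<phi> x0).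
          \<omega>' \<bullet> (hessian \<phi> x0 *v \<omega>') \<le> \<omega> \<bullet> (hessian \<phi> x0 *v \<omega>)) \<and>
        \<omega> \<bullet> (hessian \<phi> x0 *v \<omega>) \<ge> 0))"

end

theory Submission
  imports Defs
begin

text \<open>Let \<open>\<phi>\<close> touch \<open>u\<close> from above at \<open>x0\<close>, with gradient \<open>p\<close> and Hessian \<open>X\<close> there. If
  \<open>S\<^sup>+u \<le> k\<close> near \<open>x0\<close>, then \<open>u\<close> grows along every direction \<open>q\<close> at a rate of at most
  \<open>L(q) + k\<close>; comparing \<open>\<phi>\<close> with \<open>u\<close> behind \<open>x0\<close> gives \<open>p \<bullet> q \<le> L(q) + k\<close>, hence
  \<open>H(p) \<le> k\<close>. Upper semicontinuity therefore yields \<open>H(p) \<le> S\<^sup>+u(x0)\<close>, and convexity in time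
  upgrades this to \<open>u(x0) + t H(p) \<le> T\<^sup>tu(x0)\<close> for small \<open>t\<close>. A near-maximizer
  \<open>x0 + t q\<^sub>t\<close> in the definition of \<open>T\<^sup>tu(x0)\<close> has bounded \<open>q\<^sub>t\<close>, since \<open>L\<close> is superlinear.
  The second-order expansion of \<open>\<phi>\<close> and \<open>p \<bullet> q - L(q) \<le> H(p)\<close> then force
  \<open>q\<^sub>t \<bullet> X q\<^sub>t \<ge> -o(1)\<close> and \<open>L(q\<^sub>t) \<le> p \<bullet> q\<^sub>t - H(p) + O(t)\<close>, so limit points of \<open>q\<^sub>t\<close> are
  subgradients of \<open>H\<close> at \<open>p\<close> on which \<open>X\<close> is nonnegative.\<close>

section \<open>Subgradients of finite convex functions\<close>

text \<open>The strict epigraph is convex and misses \<open>(p, H p)\<close>, so a hyperplane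
  separates the two. It is not vertical because \<open>H\<close> is finite everywhere, and its slope
  is a subgradient.\<close>

lemma subdifferential_nonempty:
  fixes H :: "real^'n \<Rightarrow> real"
  assumes "convex_on UNIV H"
  shows "subdifferential H p \<noteq> {}"
proof -
  define A where "A = {z :: (real^'n) \<times> real. H (fst z) < snd z}"
  have "convex A"
    unfolding convex_def
  proof (intro ballI allI impI)
    fix x y :: "(real^'n) \<times> real" and a b :: real
    assume xy: "x \<in> A" "y \<in> A" and ab: "0 \<le> a" "0 \<le> b" "a + b = 1"
    have "H (a *\<^sub>R fst x + b *\<^sub>R fst y) \<le> a * H (fst x) + b * H (fst y)"
      using assms ab unfolding convex_on_def by auto
    also have "\<dots> < a * snd x + b * snd y"
    proof (cases "a = 0")
      case True
      then show ?thesis using ab xy by (simp add: A_def)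
    next
      case False
      then have "a * H (fst x) < a * snd x"
        using ab xy by (simp add: A_def)
      moreover have "b * H (fst y) \<le> b * snd y"
        using ab xy by (intro mult_left_mono) (auto simp: A_def)
      ultimately show ?thesis by linarith
    qed
    finally show "a *\<^sub>R x + b *\<^sub>R y \<in> A"
      by (simp add: A_def)
  qed
  moreover have "(p, H p + 1) \<in> A" "(p, H p) \<notin> A"
    by (auto simp: A_def)
  ultimately obtain a b where a: "a \<noteq> 0" and sep: "a \<bullet> (p, H p) \<le> b" "\<And>z. z \<in> A \<Longrightarrow> a \<bullet> z \<ge> b"
    using separating_hyperplane_sets[of "{(p, H p)}" A] by (metis (no_types, lifting)
        convex_singleton disjoint_insert(1) empty_iff inf_bot_left insert_disjoint(1) singletonI)
  obtain v c where vc: "a = (v, c)" by (cases a)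
  have ineq: "v \<bullet> p + c * H p \<le> v \<bullet> x + c * r" if "H x < r" for x r
    using sep(1) sep(2)[of "(x, r)"] that by (auto simp: vc A_def)
  have "c \<ge> 0"
    using ineq[of p "H p + 1"] by (simp add: algebra_simps)
  moreover have "c \<noteq> 0"
  proof
    assume "c = 0"
    then have "v \<bullet> p \<le> v \<bullet> (p - v)"
      using ineq[of "p - v" "H (p - v) + 1"] by simp
    then have "v = 0"
      by (simp add: inner_diff_right) (metis inner_gt_zero_iff not_le)
    with \<open>c = 0\<close> a vc show False by (simp add: zero_prod_def)
  qed
  ultimately have c: "c > 0" by simp
  \<comment> \<open>Only points strictly above the graph lie in \<open>A\<close>; the inequality on
    the graph itself needs the slack \<open>e\<close>.\<close>
  have "H p + (x - p) \<bullet> ((-1 / c) *\<^sub>R v) \<le> H x" for x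
  proof (rule field_le_epsilon)
    fix e :: real
    assume "e > 0"
    then have "v \<bullet> p + c * H p \<le> v \<bullet> x + c * (H x + e)"
      by (intro ineq) simp
    then have "c * (H p + (x - p) \<bullet> ((-1 / c) *\<^sub>R v)) \<le> c * (H x + e)"
      using c by (simp add: algebra_simps inner_diff_right inner_diff_left inner_commute)
    then show "H p + (x - p) \<bullet> ((-1 / c) *\<^sub>R v) \<le> H x + e"
      using c by simp
  qed
  then show ?thesis unfolding subdifferential_def by blast
qed

lemma convex_on_UNIV_bounded_above_cball:
  fixes H :: "'a::euclidean_space \<Rightarrow> real"
  assumes "convex_on UNIV H"
  obtains C where "\<And>p. p \<in> cball a R \<Longrightarrow> H p \<le> C"
proof -
  have "continuous_on (cball a R) H"
    using convex_on_continuous[OF open_UNIV assms] continuous_on_subset by blast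
  then have "bounded (H ` cball a R)"
    by (intro compact_imp_bounded compact_continuous_image compact_cball)
  then obtain C where "\<forall>p\<in>cball a R. \<bar>H p\<bar> \<le> C"
    by (auto simp: bounded_iff)
  then show ?thesis by (intro that[of C]) (auto dest: bspec)
qed

text \<open>An intersection of closed half-spaces is closed. Testing a subgradient \<open>y\<close>
  at \<open>p + sgn y\<close> bounds \<open>norm y\<close> by the oscillation of \<open>H\<close> on
  the unit ball around \<open>p\<close>. Compactness is what makes the maximum in the subsolution
  condition attained.\<close>

lemma compact_subdifferential:
  fixes H :: "real^'n \<Rightarrow> real"
  assumes "convex_on UNIV H"
  shows "compact (subdifferential H p)"
proof -
  have "closed (\<Inter>x. {y. H p + (x - p) \<bullet> y \<le> H x})"
    by (intro closed_INT ballI closed_Collect_le continuous_intros)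
  moreover have "(\<Inter>x. {y. H p + (x - p) \<bullet> y \<le> H x}) = subdifferential H p"
    by (auto simp: subdifferential_def)
  ultimately have "closed (subdifferential H p)" by simp
  moreover obtain C where C: "\<And>x. x \<in> cball p 1 \<Longrightarrow> H x \<le> C"
    using convex_on_UNIV_bounded_above_cball[OF assms] by blast
  have "norm y \<le> C - H p" if "y \<in> subdifferential H p" for y
  proof -
    have "H (p + sgn y) \<ge> H p + sgn y \<bullet> y"
      using that unfolding subdifferential_def by (auto dest: spec[of _ "p + sgn y"])
    moreover have "H (p + sgn y) \<le> C"
      by (intro C) (simp add: dist_norm norm_sgn)
    moreover have "sgn y \<bullet> y = norm y"
      by (cases "y = 0") (simp_all add: sgn_div_norm dot_square_norm power2_eq_square)
    ultimately show ?thesis by linarith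
  qed
  then have "bounded (subdifferential H p)"
    unfolding bounded_iff by blast
  ultimately show ?thesis
    using compact_eq_bounded_closed by blast
qed

section \<open>The Lagrangian and the Hopf-Lax operator\<close>

lemma lagrangian_ge: "ereal (p \<bullet> q - H p) \<le> lagrangian H q"
  unfolding lagrangian_def by (intro SUP_upper) simp

text \<open>The equality case of Fenchel's inequality: the subgradient inequality says that
  \<open>p\<close> attains the supremum defining \<open>L(q)\<close>.\<close>

lemma lagrangian_subdifferential:
  assumes "q \<in> subdifferential H p"
  shows "lagrangian H q = ereal (p \<bullet> q - H p)"
proof (rule antisym)
  have "p' \<bullet> q - H p' \<le> p \<bullet> q - H p" for p'
    using assms by (auto simp: subdifferential_def inner_diff_left dest: spec[of _ p'])
  then show "lagrangian H q \<le> ereal (p \<bullet> q - H p)"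
    unfolding lagrangian_def by (intro SUP_least) simp
qed (rule lagrangian_ge)

lemma hopf_lax_ge:
  assumes "t > 0" "x + t *\<^sub>R q \<in> U"
  shows "ereal (u (x + t *\<^sub>R q)) - ereal t * lagrangian H q \<le> hopf_lax H U u t x"
proof -
  have "(1 / t) *\<^sub>R (x + t *\<^sub>R q - x) = q" using assms by simp
  then show ?thesis
    using assms SUP_upper[of "x + t *\<^sub>R q" U
        "\<lambda>y. ereal (u y) - ereal t * lagrangian H ((1 / t) *\<^sub>R (y - x))"]
    unfolding hopf_lax_def by simp
qed

text \<open>For \<open>t > 0\<close> the competitor \<open>y = x\<close> costs
  \<open>L(0) = 0\<close>, which gives the lower bound; \<open>L \<ge> 0\<close> gives the upper
  one. The value is thus finite and may be treated as a real number.\<close>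

lemma hopf_lax_bounds:
  assumes "H 0 = 0" "\<And>p. H p \<ge> 0" "x \<in> U" "\<And>y. y \<in> U \<Longrightarrow> u y \<le> M" "t \<ge> 0"
  shows "ereal (u x) \<le> hopf_lax H U u t x" "hopf_lax H U u t x \<le> ereal M"
proof -
  have "0 \<in> subdifferential H 0"
    using assms by (simp add: subdifferential_def)
  from lagrangian_subdifferential[OF this] have "lagrangian H 0 = 0"
    using assms by (simp add: zero_ereal_def)
  with hopf_lax_ge[of t x 0 U u H] assms show "ereal (u x) \<le> hopf_lax H U u t x"
    by (cases "t = 0") (auto simp: hopf_lax_def)
  have "ereal (u y) - ereal t * lagrangian H q \<le> ereal M" if "y \<in> U" for y q
  proof -
    have "0 \<le> lagrangian H q"
      using lagrangian_ge[of 0 q H] assms by (simp add: zero_ereal_def)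
    then have "0 \<le> ereal t * lagrangian H q"
      using assms by simp
    then have "ereal (u y) - ereal t * lagrangian H q \<le> ereal (u y)"
      by (cases "ereal t * lagrangian H q") auto
    then show ?thesis
      using assms(4)[OF that] by (meson ereal_less_eq(3) order_trans)
  qed
  then show "hopf_lax H U u t x \<le> ereal M"
    using assms by (auto simp: hopf_lax_def intro!: SUP_least)
qed

section \<open>Calculus: one-sided growth, gradient, Hessian, Taylor expansion\<close>

text \<open>Continuation argument: by continuity the bound still holds at the last point of
  \<open>S\<close>, and if that point lay before \<open>b\<close>, the local growth condition would
  carry the bound further.\<close>

lemma le_if_upper_right_Dini_le:
  fixes g :: "real \<Rightarrow> real"
  assumes "a \<le> b" and cont: "continuous_on {a..b} g"
    and dini: "\<And>s. a \<le> s \<Longrightarrow> s < b \<Longrightarrow> \<forall>\<^sub>F h in at_right 0. g (s + h) - g s \<le> c * h"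
  shows "g b - g a \<le> c * (b - a)"
proof -
  define S where "S = {s \<in> {a..b}. g s - c * s \<le> g a - c * a}"
  have "closed S"
    unfolding S_def
    by (intro continuous_on_closed_Collect_le continuous_intros cont closed_atLeastAtMost)
  moreover have "a \<in> S" "bdd_above S"
    using \<open>a \<le> b\<close> by (auto simp: S_def intro: bdd_aboveI[of _ b])
  ultimately have sup: "Sup S \<in> S"
    by (intro closed_contains_Sup) auto
  have "Sup S = b"
  proof (rule ccontr)
    assume "Sup S \<noteq> b"
    with sup have less: "a \<le> Sup S" "Sup S < b" by (auto simp: S_def)
    have "\<forall>\<^sub>F h in at_right 0. h < b - Sup S"
      using less by (intro order_tendstoD tendsto_intros) auto
    with dini[OF less] eventually_at_right_less[of 0]
    have "\<forall>\<^sub>F h in at_right 0. h > 0 \<and> h < b - Sup S \<and> g (Sup S + h) - g (Sup S) \<le> c * h"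
      by eventually_elim auto
    then obtain h where h: "h > 0" "h < b - Sup S" "g (Sup S + h) - g (Sup S) \<le> c * h"
      using eventually_happens'[OF trivial_limit_at_right_real] by blast
    then have "Sup S + h \<in> S"
      using sup by (auto simp: S_def algebra_simps)
    from cSup_upper[OF this \<open>bdd_above S\<close>] \<open>h > 0\<close> show False by simp
  qed
  with sup show ?thesis by (auto simp: S_def algebra_simps)
qed

lemma has_derivative_gradient:
  fixes f :: "real^'n \<Rightarrow> real"
  assumes "f differentiable (at x)"
  shows "(f has_derivative (\<lambda>h. gradient f x \<bullet> h)) (at x)"
proof -
  let ?D = "frechet_derivative f (at x)"
  have D: "(f has_derivative ?D) (at x)"
    using assms frechet_derivative_works by blast
  then interpret linear ?D by (rule has_derivative_linear)
  have "?D h = gradient f x \<bullet> h" for h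
  proof -
    have "?D h = ?D (\<Sum>i\<in>UNIV. h $ i *\<^sub>R axis i 1)"
      using basis_expansion[of h] by (simp add: scalar_mult_eq_scaleR)
    also have "\<dots> = gradient f x \<bullet> h"
      by (simp add: sum scaleR gradient_def partial_def inner_vec_def mult.commute)
    finally show ?thesis .
  qed
  then have "?D = (\<lambda>h. gradient f x \<bullet> h)" by (rule ext)
  with D show ?thesis by simp
qed

lemma gradient_has_derivative_hessian:
  fixes f :: "real^'n \<Rightarrow> real"
  assumes "\<And>i. partial i f differentiable (at x)"
  shows "(gradient f has_derivative (\<lambda>h. hessian f x *v h)) (at x)"
proof (subst has_derivative_componentwise_within, intro ballI)
  fix b :: "real^'n"
  assume "b \<in> Basis"
  then obtain i where b: "b = axis i 1" by (auto simp: Basis_vec_def)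
  have "(\<lambda>y. gradient f y \<bullet> b) = partial i f"
    by (simp add: b inner_axis gradient_def)
  moreover have "(\<lambda>h. (hessian f x *v h) \<bullet> b) = (\<lambda>h. gradient (partial i f) x \<bullet> h)"
    by (simp add: b inner_axis) (simp add: matrix_vector_mult_def hessian_def gradient_def inner_vec_def)
  ultimately show "((\<lambda>y. gradient f y \<bullet> b) has_derivative (\<lambda>h. (hessian f x *v h) \<bullet> b)) (at x)"
    using has_derivative_gradient[OF assms] by simp
qed

text \<open>The mean value theorem on the segment from \<open>x0\<close> to \<open>x0 + h\<close>
  expresses the remainder through the error of linearizing \<open>g\<close> at \<open>x0\<close>,
  which is at most \<open>e * norm h\<close>.\<close>

lemma second_order_Taylor_upper:
  fixes f :: "'a::euclidean_space \<Rightarrow> real"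
  assumes "open U" "x0 \<in> U" "e > 0"
    and f: "\<And>x. x \<in> U \<Longrightarrow> (f has_derivative (\<lambda>h. g x \<bullet> h)) (at x)"
    and g: "(g has_derivative D) (at x0)"
  obtains r where "r > 0"
    "\<And>h. norm h \<le> r \<Longrightarrow> f (x0 + h) \<le> f x0 + g x0 \<bullet> h + (h \<bullet> D h) / 2 + e * (norm h)\<^sup>2"
proof -
  interpret D: linear D using g by (rule has_derivative_linear)
  obtain r1 where r1: "r1 > 0" "ball x0 r1 \<subseteq> U"
    using assms open_contains_ball by blast
  obtain r2 where r2: "r2 > 0"
    "\<And>y. norm (y - x0) < r2 \<Longrightarrow> norm (g y - g x0 - D (y - x0)) \<le> e * norm (y - x0)"
    using g \<open>e > 0\<close> unfolding has_derivative_at_alt by blast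
  \<comment> \<open>Halving turns \<open>norm h \<le> r\<close> into the strict bounds that
    \<open>r1\<close> and \<open>r2\<close> require.\<close>
  define r where "r = min r1 r2 / 2"
  have "f (x0 + h) \<le> f x0 + g x0 \<bullet> h + (h \<bullet> D h) / 2 + e * (norm h)\<^sup>2" if h: "norm h \<le> r" for h
  proof -
    have less: "norm (s *\<^sub>R h) < r1" "norm (s *\<^sub>R h) < r2" "norm (s *\<^sub>R h) \<le> norm h"
      if "0 \<le> s" "s \<le> 1" for s
    proof -
      show *: "norm (s *\<^sub>R h) \<le> norm h"
        using that by (simp add: mult_left_le_one_le)
      show "norm (s *\<^sub>R h) < r1" "norm (s *\<^sub>R h) < r2"
        using * h r1 r2 by (auto simp: r_def)
    qed
    \<comment> \<open>\<open>F 1 - F 0\<close> is exactly the Taylor remainder.\<close>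
    define F where "F s = f (x0 + s *\<^sub>R h) - s * (g x0 \<bullet> h) - s\<^sup>2 * (h \<bullet> D h) / 2" for s
    have "(F has_derivative (\<lambda>d. d * ((g (x0 + s *\<^sub>R h) - g x0 - D (s *\<^sub>R h)) \<bullet> h))) (at s within {0..1})"
      if "0 \<le> s" "s \<le> 1" for s
    proof -
      have "x0 + s *\<^sub>R h \<in> U"
        using r1 less[OF that] by (auto simp: subset_iff dist_norm)
      from f[OF this] have "((\<lambda>s. f (x0 + s *\<^sub>R h)) has_derivative
          (\<lambda>d. g (x0 + s *\<^sub>R h) \<bullet> (d *\<^sub>R h))) (at s within {0..1})"
        by (rule has_derivative_compose[rotated]) (auto intro!: derivative_eq_intros)
      then show ?thesis
        unfolding F_def
        by (auto intro!: derivative_eq_intros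
            simp: fun_eq_iff algebra_simps inner_diff_left inner_diff_right D.scaleR inner_commute)
    qed
    then obtain s where s: "0 < s" "s < 1"
      and F: "F 1 - F 0 = (g (x0 + s *\<^sub>R h) - g x0 - D (s *\<^sub>R h)) \<bullet> h"
      using mvt_simple[of 0 1 F "\<lambda>s d. d * ((g (x0 + s *\<^sub>R h) - g x0 - D (s *\<^sub>R h)) \<bullet> h)"] by auto
    note F
    also have "(g (x0 + s *\<^sub>R h) - g x0 - D (s *\<^sub>R h)) \<bullet> h
        \<le> norm (g (x0 + s *\<^sub>R h) - g x0 - D (s *\<^sub>R h)) * norm h"
      by (rule norm_cauchy_schwarz)
    also have "\<dots> \<le> (e * norm (s *\<^sub>R h)) * norm h"
      using r2(2)[of "x0 + s *\<^sub>R h"] less[of s] s by (intro mult_right_mono) auto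
    also have "\<dots> \<le> (e * norm h) * norm h"
      using less(3)[of s] s \<open>e > 0\<close> by (intro mult_right_mono mult_left_mono) auto
    finally show ?thesis
      by (simp add: F_def power2_eq_square)
  qed
  moreover have "r > 0" using r1 r2 by (simp add: r_def)
  ultimately show ?thesis using that by blast
qed

section \<open>Boundedness of near-maximizing velocities\<close>

text \<open>The inner hypothesis says \<open>t L(q) \<le> u(x0 + t q) - u(x0) + t ^ 3\<close>, that
  is, \<open>x0 + t q\<close> has value at least \<open>u(x0) - t ^ 3\<close> in the Hopf-Lax
  supremum. It is written with all \<open>p\<close> to stay among real numbers. The uniform bound on
  \<open>q\<close> later allows a limit as \<open>t\<close> tends to 0.\<close>

lemma bounded_near_maximizers:
  fixes H :: "'a::euclidean_space \<Rightarrow> real"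
  assumes H: "convex_on UNIV H"
    and M: "\<And>y. y \<in> U \<Longrightarrow> \<bar>u y\<bar> \<le> M"
    and "x0 \<in> U" "r > 0"
    and K: "\<And>y. y \<in> ball x0 r \<Longrightarrow> u y - u x0 \<le> K * norm (y - x0)" "K \<ge> 0"
  obtains R where "R \<ge> 0"
    "\<forall>\<^sub>F t in at_right 0. \<forall>q. x0 + t *\<^sub>R q \<in> U \<longrightarrow>
      (\<forall>p. t * (p \<bullet> q - H p) \<le> u (x0 + t *\<^sub>R q) - u x0 + t ^ 3) \<longrightarrow> norm q \<le> R"
proof -
  have M0: "M \<ge> 0" using M[OF \<open>x0 \<in> U\<close>] by linarith
  \<comment> \<open>\<open>P * r = 2 * M + 2\<close> has to exceed the oscillation
    \<open>2 * M\<close> plus the two errors \<open>t ^ 3\<close> and \<open>t * C1\<close>, each at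
    most 1.\<close>
  define P where "P = (2 * M + 2) / r"
  have P: "P \<ge> 0" "P * r = 2 * M + 2" using \<open>r > 0\<close> M0 by (auto simp: P_def)
  obtain C1' where "\<And>p. p \<in> cball 0 P \<Longrightarrow> H p \<le> C1'"
    using convex_on_UNIV_bounded_above_cball[OF H] by blast
  moreover define C1 where "C1 = max C1' 1"
  ultimately have C1: "C1 > 0" "\<And>p. norm p \<le> P \<Longrightarrow> H p \<le> C1" by force+
  obtain C2' where "\<And>p. p \<in> cball 0 (K + 1) \<Longrightarrow> H p \<le> C2'"
    using convex_on_UNIV_bounded_above_cball[OF H] by blast
  moreover define C2 where "C2 = max C2' 0"
  ultimately have C2: "C2 \<ge> 0" "\<And>p. norm p \<le> K + 1 \<Longrightarrow> H p \<le> C2" by force+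
  \<comment> \<open>Testing with \<open>p\<close> of length \<open>a\<close> along \<open>q\<close> gives superlinearity of \<open>L\<close>: first \<open>a = P\<close>
    and boundedness of \<open>u\<close> put \<open>x0 + t q\<close> in the ball, then \<open>a = K + 1\<close> and the Lipschitz
    bound there control \<open>q\<close> itself.\<close>
  have growth: "t * (a * norm q - C) \<le> u (x0 + t *\<^sub>R q) - u x0 + t ^ 3"
    if "\<And>p. t * (p \<bullet> q - H p) \<le> u (x0 + t *\<^sub>R q) - u x0 + t ^ 3" "t > 0" "a \<ge> 0"
      "\<And>p. norm p \<le> a \<Longrightarrow> H p \<le> C" for a C t q
  proof -
    have "(a *\<^sub>R sgn q) \<bullet> q = a * norm q"
      by (cases "q = 0") (simp_all add: sgn_div_norm dot_square_norm power2_eq_square)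
    moreover have "H (a *\<^sub>R sgn q) \<le> C"
      using that by (intro that) (auto simp: norm_sgn)
    ultimately have "t * (a * norm q - C) \<le> t * ((a *\<^sub>R sgn q) \<bullet> q - H (a *\<^sub>R sgn q))"
      using \<open>t > 0\<close> by (intro mult_left_mono) auto
    with that(1)[of "a *\<^sub>R sgn q"] show ?thesis by linarith
  qed
  have "norm q \<le> C2 + 1"
    if t: "0 < t" "t < 1" "t < 1 / C1" and q: "x0 + t *\<^sub>R q \<in> U"
      "\<And>p. t * (p \<bullet> q - H p) \<le> u (x0 + t *\<^sub>R q) - u x0 + t ^ 3" for t q
  proof -
    have t3: "t ^ 3 \<le> 1" using t by (intro power_le_one) auto
    have t2: "t ^ 2 \<le> 1" using t by (intro power_le_one) auto
    have "P * (t * norm q) = t * (P * norm q - C1) + t * C1"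
      by (simp add: algebra_simps)
    also have "\<dots> \<le> 2 * M + 1 + t * C1"
      using growth[OF q(2) t(1) P(1) C1(2)] M[OF q(1)] M[OF \<open>x0 \<in> U\<close>] t3 by linarith
    also have "\<dots> < P * r"
      using t C1 P by (simp add: field_simps)
    finally have "t * norm q < r"
      using P(1) mult_left_less_imp_less by blast
    then have "u (x0 + t *\<^sub>R q) - u x0 \<le> K * (t * norm q)"
      using K(1)[of "x0 + t *\<^sub>R q"] t by (simp add: dist_norm)
    then have "t * ((K + 1) * norm q - C2) \<le> K * (t * norm q) + t ^ 3"
      using growth[OF q(2) t(1) _ C2(2), of "K + 1"] K(2) by linarith
    \<comment> \<open>The term \<open>K * (t * norm q)\<close> absorbs all but one unit of the slope
      \<open>K + 1\<close>.\<close>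
    then have "t * norm q \<le> t * (C2 + t ^ 2)"
      by (simp add: algebra_simps power3_eq_cube power2_eq_square)
    then have "norm q \<le> C2 + t ^ 2"
      using t by simp
    with t2 show ?thesis by linarith
  qed
  moreover have "\<forall>\<^sub>F t in at_right (0::real). 0 < t \<and> t < 1 \<and> t < 1 / C1"
    using C1 by (intro eventually_conj eventually_at_right_less order_tendstoD(2)[OF tendsto_ident_at]) auto
  ultimately show ?thesis
    using C2 by (intro that[of "C2 + 1"]) (auto elim!: eventually_mono)
qed

section \<open>The slope and the gradient of a touching function\<close>

text \<open>Difference quotients of a convex function at 0 are nondecreasing in \<open>t\<close>, so
  their limit superior at 0 lies below each of them. This carries information from the slope to
  positive times.\<close>

lemma slope_plus_le_difference_quotient:
  fixes H :: "real^'n \<Rightarrow> real"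
  assumes H: "H 0 = 0" "\<And>p. H p \<ge> 0"
    and x: "x \<in> U" and M: "\<And>y. y \<in> U \<Longrightarrow> u y \<le> M"
    and conv: "convex_on {0..\<delta>} (\<lambda>t. real_of_ereal (hopf_lax H U u t x))"
    and t: "0 < t" "t \<le> \<delta>"
  shows "slope_plus H U u x \<le> ereal ((real_of_ereal (hopf_lax H U u t x) - u x) / t)"
proof -
  define F where "F s = real_of_ereal (hopf_lax H U u s x)" for s
  have F: "hopf_lax H U u s x = ereal (F s)" if "s \<ge> 0" for s
    using hopf_lax_bounds[of H x U u M s] assms that unfolding F_def
    by (cases "hopf_lax H U u s x") auto
  have F0: "F 0 = u x" by (simp add: F_def hopf_lax_def)
  have conv: "convex_on {0..\<delta>} F" using conv by (simp add: F_def[abs_def])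
  have "\<forall>\<^sub>F s in at_right 0. (hopf_lax H U u s x - ereal (u x)) / ereal s \<le> ereal ((F t - u x) / t)"
    using eventually_at_right_less[of 0] order_tendstoD(2)[OF tendsto_ident_at t(1)]
  proof eventually_elim
    case (elim s)
    then have "(F 0 - F s) / (0 - s) \<le> (F 0 - F t) / (0 - t)"
      using t by (intro convex_on_slope_le[OF conv]) auto
    then have "(F s - u x) / s \<le> (F t - u x) / t"
      using minus_divide_divide[of "F s - u x" s] minus_divide_divide[of "F t - u x" t]
      by (simp add: F0)
    then show ?case
      using elim by (simp add: F)
  qed
  then show ?thesis
    unfolding slope_plus_def F_def[symmetric] by (rule Limsup_bounded)
qed

lemma touching_gradient_le_slope_plus:
  fixes H :: "real^'n \<Rightarrow> real"
  assumes H: "convex_on UNIV H"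
    and U: "open U" "x0 \<in> U" and u: "continuous_on U u"
    and usc: "usc_on U (slope_plus H U u)"
    and k: "slope_plus H U u x0 \<le> ereal k"
    and \<phi>: "(\<phi> has_derivative (\<lambda>h. p \<bullet> h)) (at x0)"
    and max: "\<forall>\<^sub>F y in at x0. u y - \<phi> y \<le> u x0 - \<phi> x0"
  shows "H p \<le> k"
proof (rule field_le_epsilon)
  fix e :: real
  assume "e > 0"
  then have "slope_plus H U u x0 < ereal (k + e)"
    using k by (metis less_ereal.simps(1) less_add_same_cancel1 order_le_less_trans)
  with usc U have "\<forall>\<^sub>F y in at x0. slope_plus H U u y < ereal (k + e)"
    unfolding usc_on_def by (metis at_within_open)
  with max have "\<forall>\<^sub>F y in at x0. slope_plus H U u y < ereal (k + e) \<and> u y - \<phi> y \<le> u x0 - \<phi> x0"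
    by eventually_elim auto
  then obtain r1 where r1: "r1 > 0" "\<And>y. y \<noteq> x0 \<Longrightarrow> dist y x0 < r1 \<Longrightarrow>
      slope_plus H U u y < ereal (k + e) \<and> u y - \<phi> y \<le> u x0 - \<phi> x0"
    unfolding eventually_at by auto
  obtain r2 where r2: "r2 > 0" "ball x0 r2 \<subseteq> U"
    using U open_contains_ball by blast
  define r where "r = min r1 r2"
  have r: "r > 0" "\<And>y. dist y x0 < r \<Longrightarrow> y \<in> U"
    "\<And>y. dist y x0 < r \<Longrightarrow> slope_plus H U u y < ereal (k + e)"
    "\<And>y. dist y x0 < r \<Longrightarrow> u y - \<phi> y \<le> u x0 - \<phi> x0"
    using r1 r2 \<open>slope_plus H U u x0 < ereal (k + e)\<close>
    by (auto simp: r_def subset_iff dist_commute) (metis order.refl)+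
  \<comment> \<open>For a subgradient \<open>L(q) = p \<bullet> q - H p\<close>, so a bound on
    \<open>p \<bullet> q - L(q)\<close> is a bound on \<open>H p\<close>. The constant
    \<open>c\<close> below is \<open>L(q) + k + e\<close>.\<close>
  obtain q where q: "q \<in> subdifferential H p"
    using subdifferential_nonempty[OF H] by blast
  define c where "c = p \<bullet> q - H p + k + e"
  \<comment> \<open>The point \<open>z + h q\<close> competes in the supremum for time
    \<open>h\<close> at \<open>z\<close>, and that supremum is below
    \<open>u z + h * (k + e)\<close> for small \<open>h\<close>.\<close>
  have increment: "\<forall>\<^sub>F h in at_right 0. u (z + h *\<^sub>R q) - u z \<le> c * h" if z: "dist z x0 < r" for z
  proof -
    have "\<forall>\<^sub>F h in at_right 0. (hopf_lax H U u h z - ereal (u z)) / ereal h < ereal (k + e)"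
      using r(3)[OF z] unfolding slope_plus_def by (rule Limsup_lessD)
    moreover have "\<forall>\<^sub>F h in at_right 0. z + h *\<^sub>R q \<in> U"
      by (rule topological_tendstoD[OF _ U(1) r(2)[OF z]]) (auto intro!: tendsto_eq_intros)
    ultimately show ?thesis
      using eventually_at_right_less[of 0]
    proof eventually_elim
      case (elim h)
      have "ereal (u (z + h *\<^sub>R q)) - ereal h * ereal (p \<bullet> q - H p) \<le> hopf_lax H U u h z"
        using hopf_lax_ge[of h z q U u H] elim lagrangian_subdifferential[OF q] by simp
      moreover have "hopf_lax H U u h z < ereal (u z + h * (k + e))"
        using elim by (cases "hopf_lax H U u h z") (auto simp: field_simps)
      ultimately have "u (z + h *\<^sub>R q) - h * (p \<bullet> q - H p) < u z + h * (k + e)"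
        by (metis ereal_minus(1) less_ereal.simps(1) order_le_less_trans times_ereal.simps(1))
      then show ?case by (simp add: c_def algebra_simps)
    qed
  qed
  \<comment> \<open>The segment runs towards \<open>x0\<close> and ends there: since
    \<open>u - \<phi>\<close> is maximal at \<open>x0\<close>, \<open>\<phi>\<close> rises along it
    by at most as much as \<open>u\<close> does.\<close>
  have touch: "\<phi> x0 \<le> \<phi> (x0 - s *\<^sub>R q) + c * s" if s: "0 < s" "s * norm q < r" for s
  proof -
    have close: "dist (x0 - s *\<^sub>R q + \<tau> *\<^sub>R q) x0 < r" if "0 \<le> \<tau>" "\<tau> \<le> s" for \<tau>
    proof -
      have "x0 - s *\<^sub>R q + \<tau> *\<^sub>R q - x0 = (\<tau> - s) *\<^sub>R q" by (simp add: algebra_simps)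
      then have "dist (x0 - s *\<^sub>R q + \<tau> *\<^sub>R q) x0 = (s - \<tau>) * norm q"
        using that by (simp add: dist_norm)
      also have "\<dots> \<le> s * norm q" using that by (intro mult_right_mono) auto
      finally show ?thesis using s by linarith
    qed
    define g where "g \<tau> = u (x0 - s *\<^sub>R q + \<tau> *\<^sub>R q)" for \<tau>
    have "g s - g 0 \<le> c * (s - 0)"
    proof (rule le_if_upper_right_Dini_le)
      show "continuous_on {0..s} g"
        unfolding g_def using r(2) close
        by (intro continuous_on_compose2[OF u] continuous_intros) auto
      show "\<forall>\<^sub>F h in at_right 0. g (\<tau> + h) - g \<tau> \<le> c * h" if "0 \<le> \<tau>" "\<tau> < s" for \<tau>
        using increment[OF close[of \<tau>]] that by (simp add: g_def algebra_simps)
    qed (use s in simp)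
    then have "u x0 - u (x0 - s *\<^sub>R q) \<le> c * s" by (simp add: g_def)
    moreover have "u (x0 - s *\<^sub>R q) - \<phi> (x0 - s *\<^sub>R q) \<le> u x0 - \<phi> x0"
      using r(4)[OF close[of 0]] s by simp
    ultimately show ?thesis by linarith
  qed
  have "((\<lambda>s. \<phi> (x0 - s *\<^sub>R q)) has_derivative (\<lambda>d. p \<bullet> (- d *\<^sub>R q))) (at 0)"
    by (rule has_derivative_compose[where g = \<phi>])
      (auto intro!: derivative_eq_intros \<phi>)
  then have deriv: "((\<lambda>s. \<phi> (x0 - s *\<^sub>R q) + c * s) has_real_derivative (c - p \<bullet> q)) (at 0)"
    unfolding has_field_derivative_def
    by (auto intro!: derivative_eq_intros simp: fun_eq_iff algebra_simps)
  \<comment> \<open>By \<open>touch\<close> the function in \<open>deriv\<close> does not drop below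
    its value at 0 for small \<open>s > 0\<close>.\<close>
  have "c - p \<bullet> q \<ge> 0"
  proof (rule ccontr)
    assume "\<not> c - p \<bullet> q \<ge> 0"
    then obtain d where d: "d > 0" "\<And>s. s > 0 \<Longrightarrow> s < d \<Longrightarrow> \<phi> (x0 - s *\<^sub>R q) + c * s < \<phi> x0"
      using has_real_derivative_neg_dec_right[OF deriv] by auto
    have "\<forall>\<^sub>F s in at_right 0. s * norm q < r"
      by (rule order_tendstoD(2)[OF _ r(1)]) (auto intro!: tendsto_eq_intros)
    with eventually_at_right_less[of 0] order_tendstoD(2)[OF tendsto_ident_at d(1)]
    have "\<forall>\<^sub>F s in at_right 0. 0 < s \<and> s < d \<and> s * norm q < r"
      by eventually_elim auto
    then obtain s where "0 < s" "s < d" "s * norm q < r"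
      using eventually_happens'[OF trivial_limit_at_right_real] by blast
    with d(2)[of s] touch[of s] show False by linarith
  qed
  then show "H p \<le> k + e" by (simp add: c_def)
qed

section \<open>The second-order condition at the touching point\<close>

text \<open>For every \<open>e > 0\<close> a near-maximizer at a small time gives a velocity in a
  fixed ball that satisfies both requirements up to \<open>e\<close>; compactness removes the
  error.\<close>

lemma touching_above_imp_subgradient:
  fixes H :: "real^'n \<Rightarrow> real"
  assumes H: "convex_on UNIV H" "H p \<ge> 0"
    and x0: "x0 \<in> U"
    and M: "\<And>y. y \<in> U \<Longrightarrow> \<bar>u y\<bar> \<le> M"
    and r: "r > 0" and K: "\<And>y. y \<in> ball x0 r \<Longrightarrow> u y - u x0 \<le> K * norm (y - x0)" "K \<ge> 0"
    and hopf_lax: "\<forall>\<^sub>F t in at_right 0. ereal (u x0 + t * H p) \<le> hopf_lax H U u t x0"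
    and max: "\<forall>\<^sub>F y in at x0. u y - \<phi> y \<le> u x0 - \<phi> x0"
    and Taylor: "\<And>e. e > 0 \<Longrightarrow> \<exists>r>0. \<forall>h. norm h \<le> r \<longrightarrow>
      \<phi> (x0 + h) \<le> \<phi> x0 + p \<bullet> h + (h \<bullet> (X *v h)) / 2 + e * (norm h)\<^sup>2"
  shows "\<exists>q\<in>subdifferential H p. q \<bullet> (X *v q) \<ge> 0"
proof -
  obtain R where R: "R \<ge> 0" "\<forall>\<^sub>F t in at_right 0. \<forall>q. x0 + t *\<^sub>R q \<in> U \<longrightarrow>
      (\<forall>p. t * (p \<bullet> q - H p) \<le> u (x0 + t *\<^sub>R q) - u x0 + t ^ 3) \<longrightarrow> norm q \<le> R"
    using bounded_near_maximizers[OF H(1) M x0 r K] by blast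
  have "bounded ((\<lambda>q. q \<bullet> (X *v q)) ` cball 0 R)"
    by (intro compact_imp_bounded compact_continuous_image compact_cball continuous_intros
        linear_continuous_on matrix_vector_mul_bounded_linear)
  then obtain B where "\<forall>q\<in>cball 0 R. \<bar>q \<bullet> (X *v q)\<bar> \<le> B"
    by (auto simp: bounded_iff)
  then have B: "\<And>q. norm q \<le> R \<Longrightarrow> q \<bullet> (X *v q) \<le> B"
    by (simp add: abs_le_iff)
  have approx: "\<exists>q. norm q \<le> R \<and> (\<forall>p'. p' \<bullet> q - H p' \<le> p \<bullet> q - H p + e) \<and> q \<bullet> (X *v q) \<ge> - e"
    if "e > 0" for e
  proof -
    \<comment> \<open>This keeps the Taylor error \<open>e' * R\<^sup>2\<close> below
      \<open>e / 4\<close>, also when \<open>R = 0\<close>.\<close>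
    define e' where "e' = e / (4 * (R\<^sup>2 + 1))"
    have e': "e' > 0" "e' * R\<^sup>2 \<le> e / 4"
      using \<open>e > 0\<close> R(1) by (auto simp: e'_def field_simps add_pos_nonneg add_nonneg_pos)
    obtain r1 where r1: "r1 > 0" "\<And>h. norm h \<le> r1 \<Longrightarrow>
        \<phi> (x0 + h) \<le> \<phi> x0 + p \<bullet> h + (h \<bullet> (X *v h)) / 2 + e' * (norm h)\<^sup>2"
      using Taylor[OF e'(1)] by blast
    obtain r2 where r2: "r2 > 0" "\<And>y. y \<noteq> x0 \<Longrightarrow> dist y x0 < r2 \<Longrightarrow> u y - \<phi> y \<le> u x0 - \<phi> x0"
      using max unfolding eventually_at by auto
    have small: "\<forall>\<^sub>F t in at_right 0. f t < a" if "a > 0" "isCont f 0" "f 0 = 0" for f :: "real \<Rightarrow> real" and a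
    proof -
      have "(f \<longlongrightarrow> 0) (at_right 0)"
        using that continuous_within_subset[of 0 UNIV f] unfolding continuous_within
        by (metis filterlim_at_split)
      then show ?thesis using order_tendstoD(2) that(1) by blast
    qed
    \<comment> \<open>The first two bounds put \<open>x0 + t q\<close> where the Taylor and touching
      estimates hold. The third, with the choice of \<open>e'\<close>, gives the Hessian bound; the
      last gives the subgradient inequality up to \<open>e\<close>.\<close>
    have "\<forall>\<^sub>F t in at_right 0. t * R < r1" "\<forall>\<^sub>F t in at_right 0. t * R < r2"
      "\<forall>\<^sub>F t in at_right 0. t < e / 4" "\<forall>\<^sub>F t in at_right 0. t * (B / 2 + e' * R\<^sup>2) + t\<^sup>2 < e"
      using r1 r2 \<open>e > 0\<close> by (auto intro!: small continuous_intros)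
    with eventually_at_right_less[of 0] hopf_lax R(2)
    have "\<forall>\<^sub>F t in at_right 0. 0 < t \<and> t * R < r1 \<and> t * R < r2 \<and> t < e / 4 \<and>
        t * (B / 2 + e' * R\<^sup>2) + t\<^sup>2 < e \<and> ereal (u x0 + t * H p) \<le> hopf_lax H U u t x0 \<and>
        (\<forall>q. x0 + t *\<^sub>R q \<in> U \<longrightarrow>
          (\<forall>p. t * (p \<bullet> q - H p) \<le> u (x0 + t *\<^sub>R q) - u x0 + t ^ 3) \<longrightarrow> norm q \<le> R)"
      by eventually_elim blast
    then obtain t where t: "0 < t" "t * R < r1" "t * R < r2" "t < e / 4"
      "t * (B / 2 + e' * R\<^sup>2) + t\<^sup>2 < e" and HL: "ereal (u x0 + t * H p) \<le> hopf_lax H U u t x0"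
      and t_R: "\<And>q. x0 + t *\<^sub>R q \<in> U \<Longrightarrow>
          (\<And>p. t * (p \<bullet> q - H p) \<le> u (x0 + t *\<^sub>R q) - u x0 + t ^ 3) \<Longrightarrow> norm q \<le> R"
      using eventually_happens'[OF trivial_limit_at_right_real] by blast
    \<comment> \<open>The supremum need not be attained. The slack \<open>t ^ 3\<close> is of higher
      order than the Hessian term, which is of order \<open>t\<^sup>2\<close>.\<close>
    have "ereal (u x0 + t * H p - t ^ 3) < ereal (u x0 + t * H p)"
      using t by simp
    also note HL
    also have "hopf_lax H U u t x0 = (SUP y\<in>U. ereal (u y) - ereal t * lagrangian H ((1 / t) *\<^sub>R (y - x0)))"
      using t by (simp add: hopf_lax_def)
    finally obtain y where y: "y \<in> U"
      "ereal (u x0 + t * H p - t ^ 3) < ereal (u y) - ereal t * lagrangian H ((1 / t) *\<^sub>R (y - x0))"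
      unfolding less_SUP_iff by blast
    define q where "q = (1 / t) *\<^sub>R (y - x0)"
    have yq: "y = x0 + t *\<^sub>R q" using t by (simp add: q_def)
    have near_max: "t * (p' \<bullet> q - H p') < u y - u x0 - t * H p + t ^ 3" for p'
    proof -
      have "ereal t * ereal (p' \<bullet> q - H p') \<le> ereal t * lagrangian H q"
        using t by (intro ereal_mult_left_mono lagrangian_ge) simp
      then have "ereal (u y) - ereal t * lagrangian H q \<le> ereal (u y) - ereal t * ereal (p' \<bullet> q - H p')"
        by (intro ereal_minus_mono) simp_all
      with y(2) have "ereal (u x0 + t * H p - t ^ 3) < ereal (u y) - ereal t * ereal (p' \<bullet> q - H p')"
        unfolding q_def by order
      then show ?thesis by simp
    qed
    \<comment> \<open>Dropping this nonnegative term brings \<open>near_max\<close> into the form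
      required by \<open>t_R\<close>.\<close>
    have "t * H p \<ge> 0" using t H(2) by simp
    with near_max have "t * (p' \<bullet> q - H p') \<le> u y - u x0 + t ^ 3" for p'
      by (smt (verit))
    then have q: "norm q \<le> R"
      using t_R y(1) unfolding yq by blast
    then have tq: "norm (t *\<^sub>R q) \<le> t * R"
      using t by (simp add: mult_left_mono)
    have "dist y x0 < r2"
      using le_less_trans[OF tq t(3)] by (simp add: yq dist_norm)
    then have "u y - u x0 \<le> \<phi> y - \<phi> x0"
      using r2(2)[of y] by (cases "y = x0") auto
    also have "\<dots> \<le> p \<bullet> (t *\<^sub>R q) + ((t *\<^sub>R q) \<bullet> (X *v (t *\<^sub>R q))) / 2 + e' * (norm (t *\<^sub>R q))\<^sup>2"
      using r1(2)[OF less_imp_le[OF le_less_trans[OF tq t(2)]]] unfolding yq by linarith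
    also have "\<dots> = t * (p \<bullet> q + t * (q \<bullet> (X *v q)) / 2 + t * (e' * (norm q)\<^sup>2))"
      using t by (simp add: matrix_vector_mult_scaleR power_mult_distrib algebra_simps power2_eq_square)
    also have "\<dots> \<le> t * (p \<bullet> q + t * (q \<bullet> (X *v q)) / 2 + t * (e' * R\<^sup>2))"
      using t q e' by (intro mult_left_mono add_left_mono power_mono) auto
    finally have upper: "u y - u x0 \<le> t * (p \<bullet> q + t * (q \<bullet> (X *v q)) / 2 + t * (e' * R\<^sup>2))" .
    have key: "p' \<bullet> q - H p' < p \<bullet> q - H p + t * ((q \<bullet> (X *v q)) / 2 + e' * R\<^sup>2 + t)" for p'
    proof -
      have "t * (p' \<bullet> q - H p') < t * (p \<bullet> q - H p + t * ((q \<bullet> (X *v q)) / 2 + e' * R\<^sup>2 + t))"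
        using near_max[of p'] upper by (simp add: algebra_simps power3_eq_cube)
      then show ?thesis using t by simp
    qed
    \<comment> \<open>With \<open>p' = p\<close> the first-order terms cancel and only the
      second-order bracket remains.\<close>
    have "0 < (q \<bullet> (X *v q)) / 2 + e' * R\<^sup>2 + t"
      using key[of p] t(1) by (simp add: zero_less_mult_iff)
    then have "- e \<le> q \<bullet> (X *v q)"
      using e'(2) t(4) by linarith
    moreover have "p' \<bullet> q - H p' \<le> p \<bullet> q - H p + e" for p'
    proof -
      have "t * ((q \<bullet> (X *v q)) / 2 + e' * R\<^sup>2 + t) \<le> t * (B / 2 + e' * R\<^sup>2 + t)"
        using B[OF q] t by (intro mult_left_mono) auto
      also have "\<dots> < e"
        using t(5) by (simp add: algebra_simps power2_eq_square)
      finally show ?thesis using key[of p'] by linarith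
    qed
    ultimately show ?thesis using q by blast
  qed
  have "\<forall>n. \<exists>q. norm q \<le> R \<and> (\<forall>p'. p' \<bullet> q - H p' \<le> p \<bullet> q - H p + inverse (real (Suc n))) \<and>
      q \<bullet> (X *v q) \<ge> - inverse (real (Suc n))"
    by (intro allI approx) simp
  then obtain Q where Q: "\<And>n. norm (Q n) \<le> R"
    "\<And>n p'. p' \<bullet> Q n - H p' \<le> p \<bullet> Q n - H p + inverse (real (Suc n))"
    "\<And>n. Q n \<bullet> (X *v Q n) \<ge> - inverse (real (Suc n))"
    by metis
  have "\<forall>n. Q n \<in> cball 0 R" using Q(1) by simp
  then obtain q \<sigma> where \<sigma>: "strict_mono \<sigma>" and "(Q \<circ> \<sigma>) \<longlonglongrightarrow> q"
    using compact_cball[of 0 R] unfolding compact_def by metis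
  then have q: "(\<lambda>n. Q (\<sigma> n)) \<longlonglongrightarrow> q" by (simp add: o_def)
  have inv: "(\<lambda>n. inverse (real (Suc (\<sigma> n)))) \<longlonglongrightarrow> 0"
    using LIMSEQ_subseq_LIMSEQ[OF LIMSEQ_inverse_real_of_nat \<sigma>] by (simp add: o_def)
  have "(\<lambda>n. p \<bullet> Q (\<sigma> n) - H p + inverse (real (Suc (\<sigma> n)))) \<longlonglongrightarrow> p \<bullet> q - H p + 0"
    by (intro tendsto_intros q inv)
  \<comment> \<open>For fixed \<open>p'\<close> both sides are continuous in the velocity, so the
    inequality passes to the limit with error 0.\<close>
  then have "p' \<bullet> q - H p' \<le> p \<bullet> q - H p + 0" for p'
    by (rule LIMSEQ_le[of "\<lambda>n. p' \<bullet> Q (\<sigma> n) - H p'", rotated])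
      (auto intro!: tendsto_intros q Q(2) simp del: of_nat_Suc)
  then have "q \<in> subdifferential H p"
    by (auto simp: subdifferential_def inner_diff_left algebra_simps)
  moreover have "- 0 \<le> q \<bullet> (X *v q)"
    by (rule LIMSEQ_le[OF tendsto_minus[OF inv], of "\<lambda>n. Q (\<sigma> n) \<bullet> (X *v Q (\<sigma> n))"])
      (auto intro!: tendsto_intros q Q(3) bounded_linear.tendsto[OF matrix_vector_mul_bounded_linear] simp del: of_nat_Suc)
  ultimately show ?thesis by auto
qed

section \<open>Assembling the subsolution property\<close>

theorem propositionA1:
  fixes H :: "real^'n \<Rightarrow> real" and U :: "(real^'n) set" and u :: "real^'n \<Rightarrow> real"
  assumes "convex_on UNIV H"
    and "H 0 = 0"
    and "\<And>p. H p \<ge> 0"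
    and "bounded {p. H p = 0}"
    and "interior {p. H p = 0} = {}"
    and "open U"
    and "lip_loc U u"
    and "pointwise_convexity_criterion H U u"
  shows "aronsson_viscosity_subsolution H U u"
proof -
  have usc: "usc_on U (slope_plus H U u)" and "bounded (u ` U)"
    and conv: "\<And>x. x \<in> U \<Longrightarrow> \<exists>\<delta>>0. convex_on {0..\<delta>} (\<lambda>t. real_of_ereal (hopf_lax H U u t x))"
    using assms(8) by (auto simp: pointwise_convexity_criterion_def)
  then obtain M where M: "\<And>y. y \<in> U \<Longrightarrow> \<bar>u y\<bar> \<le> M"
    by (auto simp: bounded_iff)
  have lip: "\<exists>r>0. \<exists>K. K-lipschitz_on (ball x r) u" if "x \<in> U" for x
  proof -
    obtain r where r: "r > 0" "cball x r \<subseteq> U"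
      using \<open>open U\<close> \<open>x \<in> U\<close> unfolding open_contains_cball by blast
    then have "ball x r \<lless> U"
      by (simp add: compactly_inside_def)
    with \<open>lip_loc U u\<close> r show ?thesis
      unfolding lip_loc_def by blast
  qed
  have "isCont u x" if x: "x \<in> U" for x
  proof -
    obtain r K where "r > 0" "K-lipschitz_on (ball x r) u"
      using lip[OF x] by blast
    then show ?thesis
      using lipschitz_on_continuous_on[of K "ball x r" u] continuous_on_eq_continuous_at[of "ball x r" u]
      by simp
  qed
  then have cont: "continuous_on U u"
    by (simp add: continuous_at_imp_continuous_on)
  have "usc_on U u"
    using cont unfolding usc_on_def continuous_on_def by (auto intro: order_tendstoD(2))
  moreover have "\<exists>\<omega>\<in>subdifferential H (gradient \<phi> x0).
        (\<forall>\<omega>'\<in>subdifferential H (gradient \<phi> x0).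
          \<omega>' \<bullet> (hessian \<phi> x0 *v \<omega>') \<le> \<omega> \<bullet> (hessian \<phi> x0 *v \<omega>)) \<and>
        \<omega> \<bullet> (hessian \<phi> x0 *v \<omega>) \<ge> 0"
    if x0: "x0 \<in> U" and "smooth_on U \<phi>"
      and "\<forall>\<^sub>F y in at x0 within U. u y - \<phi> y \<le> u x0 - \<phi> x0" for \<phi> x0
  proof -
    have max: "\<forall>\<^sub>F y in at x0. u y - \<phi> y \<le> u x0 - \<phi> x0"
      using that(3) unfolding at_within_open[OF x0 \<open>open U\<close>] .
    let ?p = "gradient \<phi> x0" and ?X = "hessian \<phi> x0"
    have "Ck_on (Suc (Suc 0)) U \<phi>"
      using \<open>smooth_on U \<phi>\<close> unfolding smooth_on_def by blast
    then have "\<And>x. x \<in> U \<Longrightarrow> \<phi> differentiable (at x)" "\<And>i. partial i \<phi> differentiable (at x0)"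
      using x0 by auto
    then have \<phi>: "\<And>x. x \<in> U \<Longrightarrow> (\<phi> has_derivative (\<lambda>h. gradient \<phi> x \<bullet> h)) (at x)"
      and D\<phi>: "(gradient \<phi> has_derivative (\<lambda>h. ?X *v h)) (at x0)"
      by (auto intro: has_derivative_gradient gradient_has_derivative_hessian)
    obtain \<delta> where \<delta>: "\<delta> > 0" "convex_on {0..\<delta>} (\<lambda>t. real_of_ereal (hopf_lax H U u t x0))"
      using conv[OF x0] by blast
    have M': "u y \<le> M" if "y \<in> U" for y using M[OF that] by simp
    \<comment> \<open>The touching lemma is applied with \<open>k\<close> equal to the difference
      quotient at time \<open>t\<close>, which dominates the slope at \<open>x0\<close> by convexity
      in time.\<close>
    have HL: "ereal (u x0 + t * H ?p) \<le> hopf_lax H U u t x0" if t: "0 < t" "t \<le> \<delta>" for t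
    proof -
      obtain F where F: "hopf_lax H U u t x0 = ereal F"
        using hopf_lax_bounds[where H = H and u = u and M = M and t = t, OF assms(2,3) x0 M'] t
        by (cases "hopf_lax H U u t x0") auto
      have "H ?p \<le> (F - u x0) / t"
        using slope_plus_le_difference_quotient[where H = H and u = u and M = M, OF assms(2,3) x0 M' \<delta>(2) t] F
        by (intro touching_gradient_le_slope_plus[OF assms(1) \<open>open U\<close> x0 cont usc _ \<phi>[OF x0] max]) simp
      then show ?thesis using t F by (simp add: field_simps)
    qed
    have ev: "\<forall>\<^sub>F t in at_right 0. ereal (u x0 + t * H ?p) \<le> hopf_lax H U u t x0"
      using eventually_at_right_less[of 0] order_tendstoD(2)[OF tendsto_ident_at \<delta>(1)]
      by eventually_elim (auto intro: HL)
    obtain r K where r: "r > 0" and K: "K-lipschitz_on (ball x0 r) u"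
      using lip[OF x0] by blast
    have "u y - u x0 \<le> K * norm (y - x0)" if "y \<in> ball x0 r" for y
      using lipschitz_onD[OF K that, of x0] r by (simp add: dist_norm)
    then obtain q where q: "q \<in> subdifferential H ?p" "q \<bullet> (?X *v q) \<ge> 0"
      using touching_above_imp_subgradient[OF assms(1,3) x0 M r _ lipschitz_on_nonneg[OF K] ev max]
        second_order_Taylor_upper[OF \<open>open U\<close> x0 _ \<phi> D\<phi>] by metis
    \<comment> \<open>The maximum over the compact subdifferential is attained, and it is
      nonnegative because it dominates the value at \<open>q\<close>.\<close>
    have "continuous_on (subdifferential H ?p) (\<lambda>\<omega>. \<omega> \<bullet> (?X *v \<omega>))"
      by (intro continuous_intros linear_continuous_on matrix_vector_mul_bounded_linear)
    from continuous_attains_sup[OF compact_subdifferential[OF assms(1)] subdifferential_nonempty[OF assms(1)] this]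
    obtain \<omega> where "\<omega> \<in> subdifferential H ?p"
      "\<And>\<omega>'. \<omega>' \<in> subdifferential H ?p \<Longrightarrow> \<omega>' \<bullet> (?X *v \<omega>') \<le> \<omega> \<bullet> (?X *v \<omega>)"
      by blast
    with q show ?thesis by (meson order_trans)
  qed
  ultimately show ?thesis
    unfolding aronsson_viscosity_subsolution_def by blast
qed

end
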